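(* Let $\mathcal{X}$ be a separable Banach space with dual $\mathcal{X}^*$, and let $(\{f_n\}_{n\in\mathbb{N}}, \{\tau_n\}_{n\in\mathbb{N}})$, with $f_n\in\mathcal{X}^*$ and $\tau_n\in\mathcal{X}$, be an approximate Schauder frame for $\mathcal{X}$ that is bounded below and intrinsically localized. Then there exist a natural number $N\geq 1$ and a partition of $\mathbb{N}$ into sets $Q_1,\dots,Q_N$, $\mathbb{N}=\bigcup_{j=1}^N Q_j$, such that for each $1\leq j\leq N$, $$\inf_{n\in Q_j}\left(|f_n(\tau_n)|-\sum_{m\in Q_j,\, m\neq n}|f_n(\tau_m)|\right)>0.$$
   Context: $\mathbb{N}=\{1,2,3,\dots\}$. Let $\mathcal{X}$ be a separable (real or complex) Banach space with dual $\mathcal{X}^*$, let $\{\tau_n\}_{n\in\mathbb{N}}$ be a collection in $\mathcal{X}$ and $\{f_n\}_{n\in\mathbb{N}}$ a collection in $\mathcal{X}^*$. The pair $(\{f_n\}_n,\{\tau_n\}_n)$ is an approximate Schauder frame (ASF) for $\mathcal{X}$ if the frame operator $S_{f,\tau}:\mathcal{X}\to\mathcal{X}$, $S_{f,\tau}x=\sum_{n=1}^\infty f_n(x)\tau_n$, is a well-defined (the series converges in $\mathcal{X}$ for every $x$) bounded linear invertible operator. An ASF $(\{f_n\}_n,\{\tau_n\}_n)$ is bounded below if $\inf_{n\in\mathbb{N}}|f_n(\tau_n)|>0$. An ASF $(\{f_n\}_n,\{\tau_n\}_n)$ is intrinsically (self) localized if there exist $s>1$ and $A>0$ such that $|f_n(\tau_m)|\leq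 \dfrac{A}{(1+|n-m|)^s}$ for all $n,m\in\mathbb{N}$. The members of a partition are nonempty and pairwise disjoint. *)

theory Defs
  imports "HOL-Analysis.Analysis"
begin

text \<open>
  The class \<^class>\<open>banach\<close> only knows real scalars, so the scalar multiplication is a parameter.
  The scalar field ranges over \<^class>\<open>real_normed_field\<close>, whose norm is multiplicative. Its
  instances include \<^typ>\<open>real\<close> and \<^typ>\<open>complex\<close>, and by Gelfand--Mazur every instance is
  isometrically isomorphic to one of these two. The last axiom identifies the real structure
  of the type with the restriction of scalars.
\<close>

locale normed_space_over = vector_space smul
  for smul :: "'k::real_normed_field \<Rightarrow> 'a::real_normed_vector \<Rightarrow> 'a" +
  assumes norm_smul: "norm (smul c x) = norm c * norm x"
    and smul_of_real: "smul (of_real r) x = r *\<^sub>R x"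

lemma normed_space_over_scaleR:
  "normed_space_over (scaleR :: real \<Rightarrow> 'a::real_normed_vector \<Rightarrow> 'a)"
  by unfold_locales (simp_all add: scaleR_add_left scaleR_add_right)

lemma normed_space_over_mult:
  "normed_space_over ((*) :: 'k::real_normed_field \<Rightarrow> 'k \<Rightarrow> 'k)"
  by unfold_locales (simp_all add: distrib_left distrib_right mult.assoc norm_mult scaleR_conv_of_real)

definition bounded_linear_over ::
  "('k::real_normed_field \<Rightarrow> 'a::real_normed_vector \<Rightarrow> 'a) \<Rightarrow>
   ('k \<Rightarrow> 'b::real_normed_vector \<Rightarrow> 'b) \<Rightarrow> ('a \<Rightarrow> 'b) \<Rightarrow> bool" where
  "bounded_linear_over s1 s2 T \<longleftrightarrow>
     Vector_Spaces.linear s1 s2 T \<and> (\<exists>C. \<forall>x. norm (T x) \<le> C * norm x)"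

definition dual_space ::
  "('k::real_normed_field \<Rightarrow> 'a::real_normed_vector \<Rightarrow> 'a) \<Rightarrow> ('a \<Rightarrow> 'k) set" where
  "dual_space smul = {g. bounded_linear_over smul (*) g}"

text \<open>
  Sequences are indexed by the positive integers; the value at \<open>0\<close> of a function on
  \<^typ>\<open>nat\<close> is never used. Hence the shift by \<^const>\<open>Suc\<close> in the series.
\<close>

definition frame_operator ::
  "('k::real_normed_field \<Rightarrow> 'a::real_normed_vector \<Rightarrow> 'a) \<Rightarrow>
   (nat \<Rightarrow> 'a \<Rightarrow> 'k) \<Rightarrow> (nat \<Rightarrow> 'a) \<Rightarrow> 'a \<Rightarrow> 'a" where
  "frame_operator smul f \<tau> x = (\<Sum>n. smul (f (Suc n) x) (\<tau> (Suc n)))"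

definition approximate_Schauder_frame ::
  "('k::real_normed_field \<Rightarrow> 'a::real_normed_vector \<Rightarrow> 'a) \<Rightarrow>
   (nat \<Rightarrow> 'a \<Rightarrow> 'k) \<Rightarrow> (nat \<Rightarrow> 'a) \<Rightarrow> bool" where
  "approximate_Schauder_frame smul f \<tau> \<longleftrightarrow>
     (\<forall>x. summable (\<lambda>n. smul (f (Suc n) x) (\<tau> (Suc n)))) \<and>
     bounded_linear_over smul smul (frame_operator smul f \<tau>) \<and>
     (\<exists>T. bounded_linear_over smul smul T \<and>
          T \<circ> frame_operator smul f \<tau> = id \<and> frame_operator smul f \<tau> \<circ> T = id)"

definition frame_bounded_below ::
  "(nat \<Rightarrow> 'a::real_normed_vector \<Rightarrow> 'k::real_normed_field) \<Rightarrow> (nat \<Rightarrow> 'a) \<Rightarrow> bool" where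
  "frame_bounded_below f \<tau> \<longleftrightarrow> (INF n\<in>{1..}. norm (f n (\<tau> n))) > 0"

definition intrinsically_localized ::
  "(nat \<Rightarrow> 'a::real_normed_vector \<Rightarrow> 'k::real_normed_field) \<Rightarrow> (nat \<Rightarrow> 'a) \<Rightarrow> bool" where
  "intrinsically_localized f \<tau> \<longleftrightarrow>
     (\<exists>s>1. \<exists>A>0. \<forall>n\<ge>1. \<forall>m\<ge>1.
        norm (f n (\<tau> m)) \<le> A / (1 + \<bar>real n - real m\<bar>) powr s)"

text \<open>
  In \<open>diagonal_gap\<close>, infimum and sum are taken in \<^typ>\<open>ereal\<close>, where every sum of nonnegative
  terms and every infimum exists: a divergent sum, or a set of values that is not bounded
  below, gives \<open>-\<infinity>\<close> rather than an unspecified real.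
\<close>

definition diagonal_gap ::
  "(nat \<Rightarrow> 'a::real_normed_vector \<Rightarrow> 'k::real_normed_field) \<Rightarrow> (nat \<Rightarrow> 'a) \<Rightarrow> nat set \<Rightarrow> ereal"
  where
  "diagonal_gap f \<tau> Q =
     (INF n\<in>Q. ereal (norm (f n (\<tau> n))) - (\<Sum>\<^sub>\<infinity>m\<in>Q - {n}. ereal (norm (f n (\<tau> m)))))"

end

(* Split the positive integers into residue classes modulo N. Within a class distinct indices
   differ by nonzero multiples of N, so the off-diagonal sum of a row is at most
   2 A zeta(s) / N, which for large N is below half of the lower bound of the diagonal. *)
theory Submission
  imports Defs
begin

text \<open>Reindexing along the injective \<open>g\<close> gives a finite subsum of the nonnegative
  series for zeta(s), which converges since \<open>s > 1\<close>. The index \<open>k = 0\<close>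
  adds nothing, because \<open>0 powr - s = 0\<close>.\<close>

lemma sum_powr_minus_inj_le_suminf:
  fixes g :: "'i \<Rightarrow> nat" and s :: real
  assumes "s > 1" "finite F" "inj_on g F"
  shows "(\<Sum>m\<in>F. real (g m) powr - s) \<le> (\<Sum>k. real k powr - s)"
proof -
  have "(\<Sum>m\<in>F. real (g m) powr - s) = (\<Sum>k\<in>g ` F. real k powr - s)"
    using assms(3) by (simp add: sum.reindex)
  also have "\<dots> \<le> (\<Sum>k. real k powr - s)"
    using assms by (intro sum_le_suminf) (auto simp: summable_real_powr_iff)
  finally show ?thesis .
qed

text \<open>Dividing the distances to \<open>n\<close> by \<open>N\<close> gives positive integers,
  each attained at most once on either side of \<open>n\<close>. Hence two copies of the zeta sum,
  and a factor \<open>N powr - s\<close>, which is at most \<open>1 / N\<close>.\<close>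

lemma sum_residue_class_powr_le:
  fixes s :: real and N n :: nat
  assumes s: "s > 1" and N: "N \<ge> 1" and fin: "finite F"
    and F: "\<And>m. m \<in> F \<Longrightarrow> m \<noteq> n \<and> m mod N = n mod N"
  shows "(\<Sum>m\<in>F. 1 / (1 + \<bar>real n - real m\<bar>) powr s) \<le> 2 * (\<Sum>k. real k powr - s) / N"
proof -
  let ?Z = "\<Sum>k. real k powr - s"
  \<comment> \<open>The distance of \<open>m\<close> and \<open>n\<close> in units of
    \<open>N\<close>; \<open>max\<close> and \<open>min\<close> avoid truncated subtraction on the
    naturals.\<close>
  define g where "g m = (max m n - min m n) div N" for m
  have eq: "N * g m = max m n - min m n" if "m \<in> F" for m
  proof -
    have "max m n mod N = min m n mod N"
      using F[OF that] by (simp add: max_def min_def)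
    then have "N dvd max m n - min m n"
      by (subst mod_eq_dvd_iff_nat[symmetric]) auto
    then show ?thesis
      unfolding g_def by simp
  qed
  have term_le: "1 / (1 + \<bar>real n - real m\<bar>) powr s \<le> real (g m) powr - s / N" if m: "m \<in> F" for m
  proof -
    have d: "\<bar>real n - real m\<bar> = real N * real (g m)"
      unfolding of_nat_mult[symmetric] eq[OF m] by (auto simp: max_def min_def of_nat_diff)
    \<comment> \<open>This is where \<open>m \<noteq> n\<close> enters: for \<open>g m = 0\<close>
      the claimed bound would read \<open>1 \<le> 0\<close>.\<close>
    have g: "g m > 0"
      using d F[OF m] by (intro Nat.gr0I) auto
    \<comment> \<open>Lowering the exponent of \<open>N\<close> from \<open>s\<close> to 1 keeps the
      final bound linear in \<open>1 / N\<close>.\<close>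
    have "real N * real (g m) powr s \<le> real N powr s * real (g m) powr s"
      using N s powr_mono[of 1 s "real N"] by (intro mult_right_mono) auto
    also have "\<dots> = (real N * real (g m)) powr s"
      by (simp add: powr_mult)
    also have "\<dots> \<le> (1 + \<bar>real n - real m\<bar>) powr s"
      using s d by (intro powr_mono2) auto
    finally have "1 / (1 + \<bar>real n - real m\<bar>) powr s \<le> 1 / (real N * real (g m) powr s)"
      using N g by (intro divide_left_mono mult_pos_pos) auto
    then show ?thesis
      by (simp add: powr_minus field_simps)
  qed
  \<comment> \<open>The distance to \<open>n\<close> determines \<open>m\<close> only once the side
    of \<open>n\<close> is fixed.\<close>
  have inj: "inj_on g {m\<in>F. m < n}" "inj_on g {m\<in>F. \<not> m < n}"
  proof -
    have diff_eq: "max a n - min a n = max b n - min b n" if "a \<in> F" "b \<in> F" "g a = g b" for a b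
      using eq[OF that(1)] eq[OF that(2)] that(3) by simp
    show "inj_on g {m\<in>F. m < n}"
    proof (rule inj_onI)
      fix a b assume "a \<in> {m\<in>F. m < n}" "b \<in> {m\<in>F. m < n}" "g a = g b"
      then show "a = b"
        using diff_eq[of a b] by (simp add: max_def min_def) arith
    qed
    show "inj_on g {m\<in>F. \<not> m < n}"
    proof (rule inj_onI)
      fix a b assume "a \<in> {m\<in>F. \<not> m < n}" "b \<in> {m\<in>F. \<not> m < n}" "g a = g b"
      then show "a = b"
        using diff_eq[of a b] by (simp add: max_absorb1 min_absorb2 not_less) arith
    qed
  qed
  have "(\<Sum>m\<in>F. 1 / (1 + \<bar>real n - real m\<bar>) powr s) \<le> (\<Sum>m\<in>F. real (g m) powr - s / N)"
    by (rule sum_mono) (rule term_le)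
  also have "\<dots> = (\<Sum>m\<in>F. real (g m) powr - s) / N"
    by (simp add: sum_divide_distrib)
  also have "(\<Sum>m\<in>F. real (g m) powr - s) =
      (\<Sum>m\<in>{m\<in>F. m < n}. real (g m) powr - s) + (\<Sum>m\<in>{m\<in>F. \<not> m < n}. real (g m) powr - s)"
    using fin by (subst sum.union_disjoint[symmetric]) (auto intro!: sum.cong)
  also have "\<dots> / N \<le> (?Z + ?Z) / N"
    using fin inj s by (intro divide_right_mono add_mono sum_powr_minus_inj_le_suminf) auto
  finally show ?thesis by simp
qed

theorem theorem2p7:
  fixes smul :: "'k::real_normed_field \<Rightarrow> 'a::banach \<Rightarrow> 'a"
    and f :: "nat \<Rightarrow> 'a \<Rightarrow> 'k" and \<tau> :: "nat \<Rightarrow> 'a"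
  assumes "normed_space_over smul"
    and "separable_space (euclidean :: 'a topology)"
    and "\<And>n. n \<ge> 1 \<Longrightarrow> f n \<in> dual_space smul"
    and "approximate_Schauder_frame smul f \<tau>"
    and "frame_bounded_below f \<tau>"
    and "intrinsically_localized f \<tau>"
  shows "\<exists>(N::nat) (Q :: nat \<Rightarrow> nat set). N \<ge> 1 \<and>
           (\<Union>j\<in>{1..N}. Q j) = {1..} \<and> disjoint_family_on Q {1..N} \<and> (\<forall>j\<in>{1..N}. Q j \<noteq> {}) \<and>
           (\<forall>j\<in>{1..N}. diagonal_gap f \<tau> (Q j) > 0)"
proof -
  define \<delta> where "\<delta> = (INF n\<in>{1..}. norm (f n (\<tau> n)))"
  have \<delta>: "\<delta> > 0"
    using assms(5) by (simp add: frame_bounded_below_def \<delta>_def)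
  have diag: "\<delta> \<le> norm (f n (\<tau> n))" if "n \<ge> 1" for n
    unfolding \<delta>_def using that by (intro cINF_lower bdd_belowI2[of _ 0]) auto
  obtain s A where s: "s > 1" and A: "A > 0"
    and loc: "\<And>n m. n \<ge> 1 \<Longrightarrow> m \<ge> 1 \<Longrightarrow>
      norm (f n (\<tau> m)) \<le> A / (1 + \<bar>real n - real m\<bar>) powr s"
    using assms(6) unfolding intrinsically_localized_def by blast
  define Z where "Z = (\<Sum>k. real k powr - s)"
  \<comment> \<open>Chosen so that the row bound \<open>2 * A * Z / N\<close> is at most half of the
    diagonal bound \<open>\<delta>\<close>. Passing to \<open>Suc N0\<close> makes \<open>N\<close>
    positive without examining the sign of \<open>Z\<close>.\<close>
  obtain N0 :: nat where N0: "4 * A * Z / \<delta> \<le> real N0"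
    using real_arch_simple by blast
  define N where "N = Suc N0"
  have N: "N \<ge> 1"
    by (simp add: N_def)
  have "4 * A * Z / \<delta> \<le> real N"
    using N0 by (simp add: N_def)
  then have small: "A * (2 * Z / N) \<le> \<delta> / 2"
    using \<delta> N by (simp add: field_simps)
  \<comment> \<open>Reducing \<open>j\<close> as well lets the labels run through
    \<open>{1..N}\<close>: the multiples of \<open>N\<close> form \<open>Q N\<close>.\<close>
  define Q where "Q j = {n. n \<ge> 1 \<and> n mod N = j mod N}" for j
  have row: "(\<Sum>\<^sub>\<infinity>m\<in>Q j - {n}. ereal (norm (f n (\<tau> m)))) \<le> ereal (\<delta> / 2)" if n: "n \<in> Q j" for n j
  proof -
    \<comment> \<open>A nonnegative infinite sum in \<open>ereal\<close> is the supremum of its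
      finite subsums, so a bound uniform in \<open>F\<close> suffices.\<close>
    have "sum (\<lambda>m. ereal (norm (f n (\<tau> m)))) F \<le> ereal (\<delta> / 2)"
      if F: "finite F" "F \<subseteq> Q j - {n}" for F
    proof -
      have "(\<Sum>m\<in>F. norm (f n (\<tau> m))) \<le> (\<Sum>m\<in>F. A / (1 + \<bar>real n - real m\<bar>) powr s)"
        using n F by (intro sum_mono loc) (auto simp: Q_def)
      also have "\<dots> = A * (\<Sum>m\<in>F. 1 / (1 + \<bar>real n - real m\<bar>) powr s)"
        by (simp add: sum_distrib_left)
      also have "\<dots> \<le> A * (2 * Z / N)"
        unfolding Z_def using n F A s N
        by (intro mult_left_mono sum_residue_class_powr_le) (auto simp: Q_def)
      finally show ?thesis
        using small by simp
    qed
    then have "(SUP F\<in>{F. finite F \<and> F \<subseteq> Q j - {n}}. \<Sum>m\<in>F. ereal (norm (f n (\<tau> m))))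
        \<le> ereal (\<delta> / 2)"
      by (intro SUP_least) blast
    moreover have "(\<Sum>\<^sub>\<infinity>m\<in>Q j - {n}. ereal (norm (f n (\<tau> m)))) =
        (SUP F\<in>{F. finite F \<and> F \<subseteq> Q j - {n}}. \<Sum>m\<in>F. ereal (norm (f n (\<tau> m))))"
      by (rule nonneg_infsum_complete) simp
    ultimately show ?thesis
      by simp
  qed
  have gap: "diagonal_gap f \<tau> (Q j) > 0" for j
  proof -
    \<comment> \<open>The bound \<open>\<delta> - \<delta> / 2\<close> does not depend on
      \<open>n\<close>, so positivity survives the infimum.\<close>
    have "ereal (\<delta> / 2) \<le> diagonal_gap f \<tau> (Q j)"
      unfolding diagonal_gap_def
    proof (rule INF_greatest)
      fix n assume n: "n \<in> Q j"
      then have "\<delta> \<le> norm (f n (\<tau> n))"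
        by (intro diag) (simp add: Q_def)
      then have "ereal \<delta> - ereal (\<delta> / 2) \<le>
          ereal (norm (f n (\<tau> n))) - (\<Sum>\<^sub>\<infinity>m\<in>Q j - {n}. ereal (norm (f n (\<tau> m))))"
        using row[OF n] by (intro ereal_minus_mono) auto
      then show "ereal (\<delta> / 2) \<le>
          ereal (norm (f n (\<tau> n))) - (\<Sum>\<^sub>\<infinity>m\<in>Q j - {n}. ereal (norm (f n (\<tau> m))))"
        by simp
    qed
    moreover have "0 < ereal (\<delta> / 2)"
      using \<delta> by simp
    ultimately show ?thesis
      by (rule less_le_trans[rotated])
  qed
  have "n \<in> (\<Union>j\<in>{1..N}. Q j)" if "n \<ge> 1" for n
  proof (cases "n mod N = 0")
    case True
    then have "n \<in> Q N"
      using that by (simp add: Q_def)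
    then show ?thesis
      using N by auto
  next
    case False
    have "n \<in> Q (n mod N)"
      using that by (simp add: Q_def)
    moreover have "n mod N \<in> {1..N}"
      using False N by (auto simp: less_imp_le)
    ultimately show ?thesis
      by blast
  qed
  then have "(\<Union>j\<in>{1..N}. Q j) = {1..}"
    by (auto simp: Q_def)
  moreover have "disjoint_family_on Q {1..N}"
  proof -
    \<comment> \<open>In \<open>{1..N}\<close> only \<open>N\<close> has residue 0; every other
      label is its own residue.\<close>
    have "a = b" if "a \<in> {1..N}" "b \<in> {1..N}" "a mod N = b mod N" for a b
      using that by (cases "a = N"; cases "b = N") auto
    then show ?thesis
      unfolding disjoint_family_on_def Q_def by auto
  qed
  moreover have "\<forall>j\<in>{1..N}. Q j \<noteq> {}"
    by (auto simp: Q_def)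
  ultimately show ?thesis
    using N gap by blast
qed

end
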